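(* Let $(X,S)$ be a minimal subshift of topological rank $2$. Then every automorphism of $(X,S)$ is a power of the shift map: if $\phi:X\to X$ is a homeomorphism with $\phi\circ S=S\circ\phi$, then $\phi=S^n$ for some $n\in\mathbb Z$.
   Context: $S$ is the shift map. Topological rank. Let $(X,T)$ be a minimal Cantor system (minimal homeomorphism of a Cantor set). A clopen Kakutani-Rohlin (CKR) partition of $X$ is a partition $\mathcal T=\{T^{-j}B(k):1\le k\le d,\ 0\le j<h(k)\}$ of $X$, where $B(1),\dots,B(d)$ are clopen, $h(k)\geq 1$ and $\bigcup_k T^{-h(k)}B(k)=\bigcup_k B(k)$; its base is $B(\mathcal T)=\bigcup_k B(k)$, and it has $d$ towers $\mathcal T(k)=\{T^{-j}B(k):0\le j<h(k)\}$. A sequence $(\mathcal T_n)_{n\ge0}$ of CKR partitions, $\mathcal T_n=\{T^{-j}B_n(k):1\le k\le d_n,0\le j<h_n(k)\}$, $\mathcal T_0=\{X\}$, is nested if for all $n$: $B(\mathcal T_{n+1})\subseteq B(\mathcal T_n)$; $\mathcal T_{n+1}$ refines $\mathcal T_n$; $\bigcap_n B(\mathcal T_n)$ is a single point; and the partitions $\mathcal T_n$ span the topology of $X$. It is primitive if for every $n\ge1$ there is $N>n$ such that every tower of $\mathcal T_N$ crosses every tower of $\mathcal T_n$ (i.e. the points of each $T^{-(h_N(k)-1)}B_N(k)$, iterated by $T$ until reaching $B_N(k)$, completely cross all towers of $\mathcal T_n$). The system has finite topological rank if it admits a primitive nested sequence of CKR partitions with $d_n\le d$ for all $n$, for some $d$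 (equivalently, a Bratteli-Vershik representation with at most $d$ vertices per level); the minimum such $d$ is its topological rank. *)

theory Defs
  imports "HOL-Analysis.Analysis" "HOL-Library.Disjoint_Sets"
begin

section \<open>Minimal Cantor systems\<close>

definition cantor_space :: "'x topology \<Rightarrow> bool" where
  "cantor_space X \<longleftrightarrow>
     X homeomorphic_space
       product_topology (\<lambda>_::nat. discrete_topology (UNIV :: bool set)) UNIV"

definition minimal_map :: "'x topology \<Rightarrow> ('x \<Rightarrow> 'x) \<Rightarrow> bool" where
  "minimal_map X T \<longleftrightarrow>
     (\<forall>C. closedin X C \<and> T ` C = C \<longrightarrow> C = {} \<or> C = topspace X)"

definition minimal_cantor_system :: "'x topology \<Rightarrow> ('x \<Rightarrow> 'x) \<Rightarrow> bool" where
  "minimal_cantor_system X T \<longleftrightarrow>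
     cantor_space X \<and> homeomorphic_map X X T \<and> minimal_map X T"

definition automorphism :: "'x topology \<Rightarrow> ('x \<Rightarrow> 'x) \<Rightarrow> ('x \<Rightarrow> 'x) \<Rightarrow> bool" where
  "automorphism X T \<phi> \<longleftrightarrow>
     homeomorphic_map X X \<phi> \<and> (\<forall>x\<in>topspace X. \<phi> (T x) = T (\<phi> x))"


section \<open>Clopen Kakutani-Rohlin partitions\<close>

text \<open>The data of a Kakutani-Rohlin partition: the number of towers \<open>d\<close>, the heights
  \<open>h k\<close> and the tower bases \<open>B k\<close>; only the indices \<open>1 \<le> k \<le> d\<close> are relevant.\<close>

record 'x kr =
  num_towers :: nat
  tower_height :: "nat \<Rightarrow> nat"
  tower_base :: "nat \<Rightarrow> 'x set"

text \<open>\<open>T\<close> is only meaningful on \<open>topspace X\<close>, so preimages are taken inside \<open>topspace X\<close>.\<close>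

definition pull :: "'x topology \<Rightarrow> ('x \<Rightarrow> 'x) \<Rightarrow> nat \<Rightarrow> 'x set \<Rightarrow> 'x set" where
  "pull X T j U = {x \<in> topspace X. (T ^^ j) x \<in> U}"

definition level :: "'x topology \<Rightarrow> ('x \<Rightarrow> 'x) \<Rightarrow> 'x kr \<Rightarrow> nat \<Rightarrow> nat \<Rightarrow> 'x set" where
  "level X T P k j = pull X T j (tower_base P k)"

definition level_indices :: "'x kr \<Rightarrow> (nat \<times> nat) set" where
  "level_indices P = (SIGMA k:{1..num_towers P}. {0..<tower_height P k})"

definition atoms :: "'x topology \<Rightarrow> ('x \<Rightarrow> 'x) \<Rightarrow> 'x kr \<Rightarrow> 'x set set" where
  "atoms X T P = (\<lambda>(k, j). level X T P k j) ` level_indices P"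

definition kr_base :: "'x kr \<Rightarrow> 'x set" where
  "kr_base P = (\<Union>k\<in>{1..num_towers P}. tower_base P k)"

text \<open>Injectivity of the indexing says that distinct levels are distinct (hence disjoint)
  elements of the partition; \<^const>\<open>partition_on\<close> includes that all levels are nonempty.\<close>

definition ckr_partition :: "'x topology \<Rightarrow> ('x \<Rightarrow> 'x) \<Rightarrow> 'x kr \<Rightarrow> bool" where
  "ckr_partition X T P \<longleftrightarrow>
     (\<forall>k\<in>{1..num_towers P}.
        openin X (tower_base P k) \<and> closedin X (tower_base P k) \<and> 1 \<le> tower_height P k) \<and>
     partition_on (topspace X) (atoms X T P) \<and>
     inj_on (\<lambda>(k, j). level X T P k j) (level_indices P) \<and>
     (\<Union>k\<in>{1..num_towers P}. pull X T (tower_height P k) (tower_base P k)) = kr_base P"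

definition nested_ckr :: "'x topology \<Rightarrow> ('x \<Rightarrow> 'x) \<Rightarrow> (nat \<Rightarrow> 'x kr) \<Rightarrow> bool" where
  "nested_ckr X T P \<longleftrightarrow>
     (\<forall>n. ckr_partition X T (P n)) \<and>
     atoms X T (P 0) = {topspace X} \<and>
     (\<forall>n. kr_base (P (Suc n)) \<subseteq> kr_base (P n)) \<and>
     (\<forall>n. refines (topspace X) (atoms X T (P (Suc n))) (atoms X T (P n))) \<and>
     (\<exists>x. (\<Inter>n. kr_base (P n)) = {x}) \<and>
     topology_generated_by (\<Union>n. atoms X T (P n)) = X"

text \<open>A tower is traversed by \<open>T\<close> from level \<open>h - 1\<close> down to level \<open>0\<close>. Tower \<open>k\<close> of \<open>Q\<close> crosses
  tower \<open>l\<close> of \<open>P\<close> if the orbit segment \<open>x, T x, \<dots>, T\<^sup>h\<^sup>-\<^sup>1 x\<close> (\<open>h\<close> the height of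
  tower \<open>k\<close>) of every point \<open>x\<close> of level \<open>h - 1\<close> contains a complete passage through tower \<open>l\<close>,
  starting at some time \<open>i\<close>.\<close>

definition tower_crosses ::
  "'x topology \<Rightarrow> ('x \<Rightarrow> 'x) \<Rightarrow> 'x kr \<Rightarrow> nat \<Rightarrow> 'x kr \<Rightarrow> nat \<Rightarrow> bool" where
  "tower_crosses X T Q k P l \<longleftrightarrow>
     (\<forall>x \<in> level X T Q k (tower_height Q k - 1).
        \<exists>i. i + tower_height P l \<le> tower_height Q k \<and>
            (T ^^ i) x \<in> level X T P l (tower_height P l - 1))"

definition primitive_ckr :: "'x topology \<Rightarrow> ('x \<Rightarrow> 'x) \<Rightarrow> (nat \<Rightarrow> 'x kr) \<Rightarrow> bool" where
  "primitive_ckr X T P \<longleftrightarrow>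
     (\<forall>n\<ge>1. \<exists>N>n. \<forall>k\<in>{1..num_towers (P N)}. \<forall>l\<in>{1..num_towers (P n)}.
        tower_crosses X T (P N) k (P n) l)"


section \<open>Topological rank\<close>

definition rank_bounded_by :: "'x topology \<Rightarrow> ('x \<Rightarrow> 'x) \<Rightarrow> nat \<Rightarrow> bool" where
  "rank_bounded_by X T d \<longleftrightarrow>
     (\<exists>P. nested_ckr X T P \<and> primitive_ckr X T P \<and> (\<forall>n. num_towers (P n) \<le> d))"

definition finite_topological_rank :: "'x topology \<Rightarrow> ('x \<Rightarrow> 'x) \<Rightarrow> bool" where
  "finite_topological_rank X T \<longleftrightarrow> (\<exists>d. rank_bounded_by X T d)"

text \<open>Only meaningful under \<^const>\<open>finite_topological_rank\<close>.\<close>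

definition topological_rank :: "'x topology \<Rightarrow> ('x \<Rightarrow> 'x) \<Rightarrow> nat" where
  "topological_rank X T = (LEAST d. rank_bounded_by X T d)"


section \<open>Subshifts\<close>

definition shift :: "(int \<Rightarrow> 'a) \<Rightarrow> (int \<Rightarrow> 'a)" where
  "shift x = (\<lambda>i. x (i + 1))"

definition full_shift :: "'a set \<Rightarrow> (int \<Rightarrow> 'a) topology" where
  "full_shift A = product_topology (\<lambda>_. discrete_topology A) UNIV"

definition subshift :: "'a set \<Rightarrow> (int \<Rightarrow> 'a) set \<Rightarrow> bool" where
  "subshift A X \<longleftrightarrow> finite A \<and> closedin (full_shift A) X \<and> shift ` X = X"

abbreviation subshift_topology :: "'a set \<Rightarrow> (int \<Rightarrow> 'a) set \<Rightarrow> (int \<Rightarrow> 'a) topology" where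
  "subshift_topology A X \<equiv> subtopology (full_shift A) X"

definition int_iterate :: "('x \<Rightarrow> 'x) \<Rightarrow> int \<Rightarrow> 'x \<Rightarrow> 'x" where
  "int_iterate f n = (if 0 \<le> n then f ^^ nat n else inv f ^^ nat (- n))"

lemma bij_shift: "bij shift"
proof (rule o_bij)
  show "(\<lambda>x i. x (i - 1)) \<circ> shift = id" "shift \<circ> (\<lambda>x i. x (i - 1)) = id"
    by (auto simp: shift_def fun_eq_iff)
qed

lemma inv_shift: "inv shift x = (\<lambda>i. x (i - 1))"
  by (rule inv_f_eq) (auto simp: bij_shift bij_is_inj shift_def)

lemma int_iterate_shift: "int_iterate shift n x = (\<lambda>i. x (i + n))"
proof -
  have "(shift ^^ m) x = (\<lambda>i. x (i + int m))" for m
    by (induction m) (auto simp: shift_def algebra_simps)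
  moreover have "(inv shift ^^ m) x = (\<lambda>i. x (i - int m))" for m
    by (induction m) (auto simp: inv_shift algebra_simps)
  ultimately show ?thesis
    by (simp add: int_iterate_def)
qed

lemma topspace_subshift_topology:
  "subshift A X \<Longrightarrow> topspace (subshift_topology A X) = X"
  by (auto simp: subshift_def dest: closedin_subset)

end

theory Submission
  imports Defs "HOL-Library.Omega_Words_Fun" "HOL-Library.Sublist"
begin

text \<open>Call two points of \<open>X\<close> left asymptotic if they agree at all negative times and differ at
  time \<open>0\<close>; such pairs exist since \<open>X\<close> is infinite. For two words \<open>u, v\<close>, any two distinct infinite
  concatenations of them that start with \<open>u\<close> and \<open>v\<close> respectively have the same longest common
  prefix. Parsing a left asymptotic pair by the two tower words of level \<open>n\<close>, the parsings agree far
  to the left, and the place where they first differ is therefore followed by a word \<open>p\<^sub>n\<close>, up to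
  time \<open>0\<close>, that does not depend on the pair. The lengths of the \<open>p\<^sub>n\<close> are unbounded because the
  bases shrink to a point, so all left asymptotic pairs share the same past.

  An automorphism \<open>\<phi>\<close> maps a left asymptotic pair \<open>(x, y)\<close> to a left asymptotic pair up to a shift,
  so that \<open>\<psi> = S\<^sup>n \<circ> \<phi>\<close> satisfies: \<open>\<psi> x\<close> and \<open>x\<close> have the same past. Any limit point of the
  backward orbit of \<open>x\<close> is then fixed by \<open>\<psi>\<close>, and \<open>\<psi>\<close> is the identity by minimality.\<close>

section \<open>Concatenations of two words\<close>

text \<open>Coinduction makes the concatenation infinite. If one of the words is empty, every
  sequence qualifies, which is why nonempty words are assumed further on.\<close>

coinductive factored :: "'a list \<Rightarrow> 'a list \<Rightarrow> (nat \<Rightarrow> 'a) \<Rightarrow> bool" for u v where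
  left: "factored u v z \<Longrightarrow> factored u v (u \<frown> z)"
| right: "factored u v z \<Longrightarrow> factored u v (v \<frown> z)"

lemma factored_swap: "factored u v z \<Longrightarrow> factored v u z"
  by (coinduction arbitrary: z) (auto elim: factored.cases)

lemma factored_same_unique:
  assumes "u \<noteq> []" "factored u u z" "factored u u z'"
  shows "z = z'"
proof
  fix n show "z n = z' n" using assms(2,3)
  proof (induction n arbitrary: z z' rule: less_induct)
    case (less n)
    obtain y y' where "z = u \<frown> y" "factored u u y" "z' = u \<frown> y'" "factored u u y'"
      using less.prems by (metis factored.cases)
    moreover have "n - length u < n" if "\<not> n < length u"
      using that assms(1) by (cases u) auto
    ultimately show ?case
      using less.IH[of "n - length u" y y'] by (cases "n < length u") auto
  qed
qed

text \<open>The cancellation step: both blocks \<open>u\<close> and \<open>u @ t\<close> begin with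
  \<open>u\<close>, and what remains after removing it can be cut into blocks \<open>u\<close> and
  \<open>t\<close>.\<close>

lemma factored_append:
  assumes "factored u (u @ t) z"
  obtains z' where "z = u \<frown> z'" "factored u t z'"
proof -
  \<comment> \<open>The coinduction has two states: at a block boundary, or with \<open>u\<close>
    already removed from a block \<open>u @ t\<close> and \<open>t\<close> still to be read.\<close>
  have *: "factored u t w" if "factored u (u @ t) w \<or> (\<exists>w'. w = t \<frown> w' \<and> factored u (u @ t) w')" for w
    using that
  proof (coinduction arbitrary: w)
    case (factored w)
    then show ?case
    proof
      assume "factored u (u @ t) w"
      then show ?thesis
        by cases (auto simp flip: conc_conc)
    qed auto
  qed
  from assms show thesis
    by cases (use * that in \<open>auto simp flip: conc_conc\<close>)
qed

text \<open>\<open>p\<close> is fixed before \<open>z\<close> and \<open>z'\<close>: one word is the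
  longest common prefix of all distinct pairs of concatenations with these first blocks.\<close>

definition branches_after :: "'a list \<Rightarrow> 'a list \<Rightarrow> 'a list \<Rightarrow> bool" where
  "branches_after u v p \<longleftrightarrow>
     (\<forall>z z'. factored u v z \<longrightarrow> factored u v z' \<longrightarrow> u \<frown> z \<noteq> v \<frown> z' \<longrightarrow>
        (\<exists>r r'. u \<frown> z = p \<frown> r \<and> v \<frown> z' = p \<frown> r' \<and> r 0 \<noteq> r' 0))"

lemma branches_after_swap: "branches_after u v p \<Longrightarrow> branches_after v u p"
  unfolding branches_after_def by (metis factored_swap)

text \<open>Both concatenations begin with \<open>u\<close>. Removing it leaves one that starts with
  \<open>u\<close> again, by \<open>factored_append\<close>, and one that starts with
  \<open>t\<close>, both over the blocks \<open>u\<close> and \<open>t\<close>.\<close>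

lemma branches_after_append:
  assumes "branches_after u t p"
  shows "branches_after u (u @ t) (u @ p)"
  unfolding branches_after_def
proof (intro allI impI)
  fix z z' assume z: "factored u (u @ t) z" "factored u (u @ t) z'"
    and ne: "u \<frown> z \<noteq> (u @ t) \<frown> z'"
  obtain y where y: "z = u \<frown> y" "factored u t y"
    using z(1) by (rule factored_append)
  obtain y' where y': "z' = u \<frown> y'" "factored u t y'"
    using z(2) by (rule factored_append)
  have "u \<frown> y \<noteq> t \<frown> z'" "factored u t z'"
    using ne y y' by (auto intro: factored.left simp flip: conc_conc)
  then obtain r r' where "u \<frown> y = p \<frown> r" "t \<frown> z' = p \<frown> r'" "r 0 \<noteq> r' 0"
    using assms y(2) unfolding branches_after_def by blast
  then show "\<exists>r r'. u \<frown> z = (u @ p) \<frown> r \<and> (u @ t) \<frown> z' = (u @ p) \<frown> r' \<and> r 0 \<noteq> r' 0"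
    using y(1) by (metis conc_conc)
qed

text \<open>The Euclidean algorithm on pairs of words: if one word is a prefix of the other, cancel it.\<close>

lemma branching_prefix:
  fixes u v :: "'a list"
  assumes "u \<noteq> []" "v \<noteq> []"
  shows "\<exists>p. branches_after u v p"
  using assms
proof (induction "length u + length v" arbitrary: u v rule: less_induct)
  case less
  have step: "\<exists>p. branches_after a b p"
    if "Sublist.prefix a b" "a \<noteq> []" "length a + length b = length u + length v" for a b :: "'a list"
  proof -
    obtain t where b: "b = a @ t" using \<open>Sublist.prefix a b\<close> by (auto simp: Sublist.prefix_def)
    show ?thesis
    proof (cases "t = []")
      \<comment> \<open>Equal words admit only one infinite concatenation, so the condition is
        vacuous.\<close>
      case True
      then show ?thesis
        using factored_same_unique[OF \<open>a \<noteq> []\<close>] b unfolding branches_after_def by force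
    next
      case False
      have "length a + length t < length u + length v"
        using that b by (cases a) auto
      then have "\<exists>p. branches_after a t p"
        using less.hyps[of a t] that(2) False by blast
      then show ?thesis using b branches_after_append by blast
    qed
  qed
  consider "Sublist.prefix u v" | "Sublist.prefix v u" | "Sublist.parallel u v"
    by blast
  then show ?case
  proof cases
    case 1
    then show ?thesis using step less.prems by blast
  next
    case 2
    then show ?thesis using step[of v u] less.prems branches_after_swap by fastforce
  next
    case 3
    then obtain p a u' b v' where "a \<noteq> b" "u = p @ a # u'" "v = p @ b # v'"
      using Sublist.parallel_decomp by blast
    moreover from this have "u \<frown> z = p \<frown> ((a # u') \<frown> z)" "v \<frown> z = p \<frown> ((b # v') \<frown> z)" for z
      by simp_all
    ultimately show ?thesis
      unfolding branches_after_def by (intro exI[of _ p] allI impI) (metis conc_fst length_greater_0_conv list.discI nth_Cons_0)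
  qed
qed

section \<open>Subshifts\<close>

definition translate :: "int \<Rightarrow> (int \<Rightarrow> 'a) \<Rightarrow> (int \<Rightarrow> 'a)" where
  "translate n x = (\<lambda>i. x (i + n))"

lemma translate_apply [simp]: "translate n x i = x (i + n)"
  by (simp add: translate_def)

lemma translate_translate [simp]: "translate m (translate n x) = translate (m + n) x"
  by (auto simp: fun_eq_iff algebra_simps)

lemma translate_0 [simp]: "translate 0 x = x"
  by (simp add: fun_eq_iff)

lemma int_iterate_shift_eq: "int_iterate shift n x = translate n x"
  by (simp add: int_iterate_shift translate_def)

lemma shift_eq_translate: "shift x = translate 1 x"
  by (simp add: shift_def translate_def)

lemma shift_funpow: "(shift ^^ n) x = translate (int n) x"
  by (induction n) (auto simp: shift_eq_translate fun_eq_iff algebra_simps)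

locale shift_space =
  fixes A :: "'a set" and X :: "(int \<Rightarrow> 'a) set"
  assumes subshift: "subshift A X"
begin

abbreviation \<T> :: "(int \<Rightarrow> 'a) topology" where
  "\<T> \<equiv> subshift_topology A X"

lemma finite_alphabet: "finite A"
  and closed_full: "closedin (full_shift A) X"
  and shift_image: "shift ` X = X"
  using subshift by (auto simp: subshift_def)

lemma topspace_eq [simp]: "topspace \<T> = X"
  using topspace_subshift_topology[OF subshift] .

declare topspace_subtopology [simp del]

lemma letter_mem: "x \<in> X \<Longrightarrow> x i \<in> A"
  using closedin_subset[OF closed_full] by (auto simp: full_shift_def)

lemma translate_mem: 
  assumes "x \<in> X" shows "translate n x \<in> X"
proof -
  have fwd: "translate (int m) x \<in> X" if "x \<in> X" for m x
    using that
  proof (induction m)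
    case (Suc m)
    then have "shift (translate (int m) x) \<in> X" using shift_image by blast
    then show ?case by (simp add: shift_eq_translate translate_def ac_simps)
  qed simp
  have bwd: "translate (- int m) x \<in> X" if "x \<in> X" for m x
    using that
  proof (induction m arbitrary: x)
    case (Suc m)
    obtain y where "y \<in> X" "x = translate 1 y"
      using Suc.prems shift_image by (auto simp: shift_eq_translate)
    then show ?case using Suc.IH[of y] by simp
  qed simp
  show ?thesis
    using fwd[OF assms, of "nat n"] bwd[OF assms, of "nat (- n)"] by (cases "n \<ge> 0") auto
qed

section \<open>Compactness, cylinders and limits of backward orbits\<close>

lemma compact: "compact_space \<T>"
proof -
  have "compact_space (full_shift A)"
    using finite_alphabet by (simp add: full_shift_def compact_space_product_topology compact_space_discrete_topology)
  then show ?thesis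
    using closed_full closedin_compact_space compact_space_subtopology by blast
qed

lemma Hausdorff: "Hausdorff_space \<T>"
  by (simp add: full_shift_def Hausdorff_space_product_topology Hausdorff_space_subtopology)

lemma continuous_letter: "continuous_map \<T> (discrete_topology A) (\<lambda>x. x i)"
  unfolding full_shift_def by (intro continuous_map_from_subtopology continuous_map_product_projection) simp

lemma openin_cylinder: "openin \<T> {x \<in> X. \<forall>i\<in>{-int m..int m}. x i = z i}" if "z \<in> X"
proof -
  have "openin \<T> {x \<in> X. x i = z i}" for i
  proof -
    have "openin \<T> {x \<in> topspace \<T>. x i \<in> {z i}}"
      using letter_mem[OF that] by (intro openin_continuous_map_preimage[OF continuous_letter]) simp
    then show ?thesis by (simp only: topspace_eq singleton_iff)
  qed
  then have "openin \<T> (\<Inter>i\<in>{-int m..int m}. {x \<in> X. x i = z i})"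
    by (intro openin_INT2) auto
  also have "(\<Inter>i\<in>{-int m..int m}. {x \<in> X. x i = z i}) = {x \<in> X. \<forall>i\<in>{-int m..int m}. x i = z i}"
    by auto
  finally show ?thesis .
qed

lemma open_contains_cylinder:
  assumes "openin \<T> U" "z \<in> U"
  obtains m :: nat where "\<And>x. x \<in> X \<Longrightarrow> (\<And>i. \<bar>i\<bar> \<le> int m \<Longrightarrow> x i = z i) \<Longrightarrow> x \<in> U"
proof -
  obtain V where V: "openin (full_shift A) V" "U = V \<inter> X"
    using assms(1) by (auto simp: openin_subtopology)
  then obtain W where W: "finite {i. W i \<noteq> A}" "\<And>i. W i \<subseteq> A"
     "z \<in> PiE UNIV W" "PiE UNIV W \<subseteq> V"
    using assms(2) unfolding full_shift_def openin_product_topology_alt by force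
  then obtain m where m: "\<And>i. W i \<noteq> A \<Longrightarrow> nat \<bar>i\<bar> \<le> m"
    using finite_nat_set_iff_bounded_le[of "(\<lambda>i. nat \<bar>i\<bar>) ` {i. W i \<noteq> A}"] by auto
  show thesis
  proof (rule that[of m])
    fix x assume x: "x \<in> X" "\<And>i. \<bar>i\<bar> \<le> int m \<Longrightarrow> x i = z i"
    have "x i \<in> W i" for i
    proof (cases "W i = A")
      case True
      then show ?thesis using letter_mem x(1) by blast
    next
      case False
      then have "x i = z i" using m x(2) by force
      then show ?thesis using W(3) by auto
    qed
    then show "x \<in> U" using V W x(1) by auto
  qed
qed

text \<open>The witness is a common point of the closures of all tails of the backward orbit, which
  are nonempty, closed and decreasing.\<close>

lemma backward_limit:
  assumes "x \<in> X"
  obtains z where "z \<in> X"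
    "\<And>U N. openin \<T> U \<Longrightarrow> z \<in> U \<Longrightarrow> \<exists>n\<ge>N::nat. translate (- int n) x \<in> U"
proof -
  define C where "C N = \<T> closure_of ((\<lambda>n. translate (- int n) x) ` {N::nat..})" for N
  have "(\<Inter>N. C N) \<noteq> {}"
  proof (rule compact_space_imp_nest[OF compact])
    show "closedin \<T> (C N)" for N by (simp add: C_def)
    have "(\<lambda>n. translate (- int n) x) ` {N..} \<subseteq> C N" for N
      unfolding C_def by (rule closure_of_subset) (use assms translate_mem in auto)
    then show "C N \<noteq> {}" for N by blast
    show "decseq C"
      unfolding C_def by (auto simp: decseq_def intro!: closure_of_mono)
  qed
  then obtain z where z: "z \<in> C N" for N by blast
  show thesis
  proof (rule that)
    show "z \<in> X" using z[of 0] by (auto simp: C_def in_closure_of)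
    show "\<exists>n\<ge>N. translate (- int n) x \<in> U" if "openin \<T> U" "z \<in> U" for U N
      using z[of N] that by (auto simp: C_def in_closure_of)
  qed
qed

text \<open>Far to the left the windows of \<open>x\<close> and \<open>y\<close> coincide, so a time
  at which one of them is near \<open>z\<close> serves for both.\<close>

lemma asymptotic_backward_limit:
  assumes "x \<in> X" "y \<in> X" and "\<And>i. i < c \<Longrightarrow> y i = x i"
  obtains z where "z \<in> X"
    "\<And>U N. openin \<T> U \<Longrightarrow> z \<in> U \<Longrightarrow>
       \<exists>n\<ge>N::nat. translate (- int n) x \<in> U \<and> translate (- int n) y \<in> U"
proof -
  obtain z where z: "z \<in> X"
    "\<And>U N. openin \<T> U \<Longrightarrow> z \<in> U \<Longrightarrow> \<exists>n\<ge>N::nat. translate (- int n) x \<in> U"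
    using backward_limit[OF assms(1)] by blast
  show thesis
  proof (rule that[OF z(1)])
    fix U N assume U: "openin \<T> U" "z \<in> U"
    then obtain m where m: "\<And>x. x \<in> X \<Longrightarrow> (\<And>i. \<bar>i\<bar> \<le> int m \<Longrightarrow> x i = z i) \<Longrightarrow> x \<in> U"
      using open_contains_cylinder by blast
    \<comment> \<open>The bound on \<open>n\<close> puts the window of radius \<open>m\<close>
      around time \<open>- int n\<close> to the left of \<open>c\<close>.\<close>
    obtain n where n: "n \<ge> max N (nat (int m + \<bar>c\<bar> + 1))"
      "translate (- int n) x \<in> {x \<in> X. \<forall>i\<in>{-int m..int m}. x i = z i}"
      using z(2)[OF openin_cylinder[OF z(1)], of m] z(1) by blast
    have "translate (- int n) x i = z i \<and> translate (- int n) y i = z i" if "\<bar>i\<bar> \<le> int m" for i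
    proof -
      have "i - int n < c" using n(1) that by linarith
      with n(2) that show ?thesis using assms(3) by (auto simp: abs_le_iff)
    qed
    then show "\<exists>n\<ge>N. translate (- int n) x \<in> U \<and> translate (- int n) y \<in> U"
      using m translate_mem assms(1,2) n(1) by (intro exI[of _ n]) auto
  qed
qed

text \<open>Compactness of the product, in the form that turns finite approximations into an actual
  pair of points.\<close>

lemma compact_pairs_nest:
  assumes "\<And>m::nat. closedin (prod_topology \<T> \<T>) (E m)" "\<And>m. E (Suc m) \<subseteq> E m" "\<And>m. E m \<noteq> {}"
  obtains x y where "x \<in> X" "y \<in> X" "\<And>m. (x, y) \<in> E m"
proof -
  have "compact_space (prod_topology \<T> \<T>)"
    using compact by (simp add: compact_space_prod_topology)
  then have "(\<Inter>m. E m) \<noteq> {}"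
    using assms by (intro compact_space_imp_nest decseq_SucI) auto
  then obtain x y where "\<And>m. (x, y) \<in> E m" by auto
  moreover have "E 0 \<subseteq> X \<times> X" using closedin_subset[OF assms(1), of 0] by simp
  ultimately show thesis using that by blast
qed

text \<open>As the alphabet is finite, any relation between two letters gives a finite union of
  closed rectangles.\<close>

lemma closedin_letters:
  assumes f: "continuous_map \<T> \<T> f"
  shows "closedin (prod_topology \<T> \<T>) {(x, y) \<in> X \<times> X. R (f x i) (f y i)}"
proof -
  have "closedin \<T> {x \<in> X. f x i = a}" if "a \<in> A" for a
  proof -
    have "continuous_map \<T> (discrete_topology A) (\<lambda>x. f x i)"
      using continuous_map_compose[OF f continuous_letter, of i] by (simp add: o_def)
    from closedin_continuous_map_preimage[OF this, of "{a}"] that show ?thesis by simp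
  qed
  then have "closedin (prod_topology \<T> \<T>) ({x \<in> X. f x i = a} \<times> {x \<in> X. f x i = b})"
    if "a \<in> A" "b \<in> A" for a b
    using that by (simp add: closedin_prod_Times_iff)
  moreover have "finite {(a, b) \<in> A \<times> A. R a b}"
    by (rule finite_subset[of _ "A \<times> A"]) (use finite_alphabet in auto)
  ultimately have "closedin (prod_topology \<T> \<T>)
      (\<Union>(a, b)\<in>{(a, b) \<in> A \<times> A. R a b}. {x \<in> X. f x i = a} \<times> {x \<in> X. f x i = b})"
    by (intro closedin_Union) auto
  moreover have "f x \<in> X" if "x \<in> X" for x
    using continuous_map_funspace[OF f] that by auto
  then have "(\<Union>(a, b)\<in>{(a, b) \<in> A \<times> A. R a b}. {x \<in> X. f x i = a} \<times> {x \<in> X. f x i = b})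
      = {(x, y) \<in> X \<times> X. R (f x i) (f y i)}"
    using letter_mem by auto
  ultimately show ?thesis by simp
qed

lemma closedin_split:
  assumes f: "continuous_map \<T> \<T> f"
  shows "closedin (prod_topology \<T> \<T>)
    {(x, y) \<in> X \<times> X. f x 0 \<noteq> f y 0 \<and> (\<forall>i\<in>I. x i = y i)}" (is "closedin _ ?S")
proof -
  have "?S = \<Inter> (insert {(x, y) \<in> X \<times> X. f x 0 \<noteq> f y 0}
     ((\<lambda>i. {(x, y) \<in> X \<times> X. id x i = id y i}) ` I))" by auto
  also have "closedin (prod_topology \<T> \<T>) \<dots>"
    using closedin_letters[OF f, of "(\<noteq>)" 0] closedin_letters[OF continuous_map_id, of "(=)"]
    by (intro closedin_Inter) auto
  finally show ?thesis .
qed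

text \<open>The finitary part of the Curtis--Hedlund--Lyndon theorem.\<close>

lemma sliding_block_window:
  assumes f: "continuous_map \<T> \<T> f"
  shows "\<exists>m::nat. \<forall>x\<in>X. \<forall>y\<in>X. (\<forall>i\<in>{- int m..int m}. x i = y i) \<longrightarrow> f x 0 = f y 0"
proof (rule ccontr)
  assume no: "\<not> ?thesis"
  \<comment> \<open>If no window suffices, compactness yields a pair that agrees on all windows,
    hence is equal, while its images still differ at time 0.\<close>
  define E where "E m = {(x, y) \<in> X \<times> X. f x 0 \<noteq> f y 0 \<and> (\<forall>i\<in>{- int m..int m}. x i = y i)}"
    for m :: nat
  have "E m \<noteq> {}" for m
  proof -
    obtain x y where "x \<in> X" "y \<in> X" "\<forall>i\<in>{- int m..int m}. x i = y i" "f x 0 \<noteq> f y 0"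
      using no by meson
    then have "(x, y) \<in> E m" by (simp add: E_def)
    then show ?thesis by blast
  qed
  moreover have "closedin (prod_topology \<T> \<T>) (E m)" for m
    unfolding E_def by (rule closedin_split[OF f])
  moreover have "E (Suc m) \<subseteq> E m" for m
    by (auto simp: E_def)
  ultimately obtain x y where *: "x \<in> X" "y \<in> X" "\<And>m. (x, y) \<in> E m"
    using compact_pairs_nest[of E] by metis
  have "x i = y i" for i
  proof -
    have "i \<in> {- int (nat \<bar>i\<bar>)..int (nat \<bar>i\<bar>)}" by auto
    then show ?thesis using *(3)[of "nat \<bar>i\<bar>"] unfolding E_def by blast
  qed
  then have "x = y" by blast
  with *(3)[of 0] show False by (simp add: E_def)
qed

section \<open>Existence of left asymptotic pairs\<close>

definition left_asymptotic :: "(int \<Rightarrow> 'a) \<Rightarrow> (int \<Rightarrow> 'a) \<Rightarrow> bool" where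
  "left_asymptotic x y \<longleftrightarrow> x \<in> X \<and> y \<in> X \<and> x 0 \<noteq> y 0 \<and> (\<forall>i<0. x i = y i)"

text \<open>Among more than \<open>card Ws\<close> points, two share the \<open>m\<close> letters
  before a position \<open>L\<close> that lies beyond none of the chosen differences. Determinism
  carries the equality to all later times, including the one where the two points differ.\<close>

lemma finite_if_past_window_determines:
  fixes m :: nat
  assumes det: "\<And>x y. x \<in> X \<Longrightarrow> y \<in> X \<Longrightarrow> (\<And>i. - int m \<le> i \<Longrightarrow> i < 0 \<Longrightarrow> x i = y i) \<Longrightarrow> x 0 = y 0"
  shows "finite X"
proof (rule ccontr)
  assume "infinite X"
  define Ws where "Ws = {xs. set xs \<subseteq> A \<and> length xs = m}"
  have fin: "finite Ws" using finite_alphabet by (simp add: Ws_def finite_lists_length_eq)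
  obtain F where F: "F \<subseteq> X" "finite F" "card F = Suc (card Ws)"
    using infinite_arbitrarily_large[OF \<open>infinite X\<close>] by blast
  \<comment> \<open>For \<open>x = y\<close> the value is arbitrary; it can only lower the bound
    \<open>L\<close>.\<close>
  define d where "d x y = (SOME i. x i \<noteq> y i)" for x y :: "int \<Rightarrow> 'a"
  have d: "x (d x y) \<noteq> y (d x y)" if "x \<noteq> y" for x y
    unfolding d_def by (rule someI_ex) (use that in auto)
  obtain L where L: "\<And>x y. x \<in> F \<Longrightarrow> y \<in> F \<Longrightarrow> L \<le> d x y"
  proof (cases "F = {}")
    case False
    show thesis
    proof (rule that[of "Min ((\<lambda>(x, y). d x y) ` (F \<times> F))"])
      fix x y assume "x \<in> F" "y \<in> F"
      then have "d x y \<in> (\<lambda>(x, y). d x y) ` (F \<times> F)" by (intro rev_image_eqI[of "(x, y)"]) simp_all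
      then show "Min ((\<lambda>(x, y). d x y) ` (F \<times> F)) \<le> d x y" using F(2) by (intro Min_le) simp_all
    qed
  qed auto
  define g where "g x = map (\<lambda>j. x (L - int (Suc j))) [0..<m]" for x :: "int \<Rightarrow> 'a"
  have "x i \<in> A" if "x \<in> F" for x i
    using that F(1) letter_mem by blast
  then have "g ` F \<subseteq> Ws" by (auto simp: g_def Ws_def)
  then have "card (g ` F) < card F" using F(3) card_mono[OF fin, of "g ` F"] by simp
  then have "\<not> inj_on g F" by (rule pigeonhole)
  then obtain x y where xy: "x \<in> F" "y \<in> F" "x \<noteq> y" "g x = g y"
    unfolding inj_on_def by blast
  have past: "x (L - int (Suc j)) = y (L - int (Suc j))" if "j < m" for j
    using arg_cong[OF xy(4), of "\<lambda>w. w ! j"] that by (simp add: g_def)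
  have agree: "x i = y i" if "L - int m \<le> i" "i < L" for i
  proof -
    have "nat (L - 1 - i) < m" "L - int (Suc (nat (L - 1 - i))) = i" using that by linarith+
    then show ?thesis using past by metis
  qed
  have "x (L + int k) = y (L + int k)" for k
  proof (induction k rule: less_induct)
    case (less k)
    have "translate (L + int k) x 0 = translate (L + int k) y 0"
    proof (rule det)
      show "translate (L + int k) x \<in> X" "translate (L + int k) y \<in> X"
        using F xy by (auto intro!: translate_mem)
      fix i :: int assume i: "- int m \<le> i" "i < 0"
      have "x (i + (L + int k)) = y (i + (L + int k))"
      proof (cases "i + int k < 0")
        case True
        then show ?thesis by (intro agree) (use i in linarith)+
      next
        case False
        then have "nat (i + int k) < k" "i + (L + int k) = L + int (nat (i + int k))"
          using i by linarith+
        then show ?thesis using less by metis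
      qed
      then show "translate (L + int k) x i = translate (L + int k) y i"
        by (simp only: translate_apply)
    qed
    then show ?case by simp
  qed
  moreover have "L + int (nat (d x y - L)) = d x y" using L[OF xy(1,2)] by simp
  ultimately have "x (d x y) = y (d x y)" by metis
  then show False using d xy(3) by blast
qed

text \<open>If for some \<open>m\<close> no two points split at time 0 after \<open>m\<close> equal
  letters, then \<open>X\<close> is finite. Otherwise compactness gives a pair with an infinite
  common past.\<close>

lemma ex_left_asymptotic:
  assumes "infinite X"
  shows "\<exists>x y. left_asymptotic x y"
proof -
  \<comment> \<open>\<open>id\<close> brings the set into the shape of
    \<open>closedin_split\<close>.\<close>
  define E where "E m = {(x, y) \<in> X \<times> X. id x 0 \<noteq> id y 0 \<and> (\<forall>i\<in>{- int m..<0}. x i = y i)}"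
    for m :: nat
  have "E m \<noteq> {}" for m
  proof
    assume "E m = {}"
    have "x 0 = y 0" if "x \<in> X" "y \<in> X" "\<And>i. - int m \<le> i \<Longrightarrow> i < 0 \<Longrightarrow> x i = y i" for x y
    proof (rule ccontr)
      assume "x 0 \<noteq> y 0"
      with that have "(x, y) \<in> E m" by (auto simp: E_def)
      with \<open>E m = {}\<close> show False by simp
    qed
    then have "finite X" by (rule finite_if_past_window_determines)
    with assms show False ..
  qed
  moreover have "closedin (prod_topology \<T> \<T>) (E m)" for m
    unfolding E_def by (rule closedin_split[OF continuous_map_id])
  moreover have "E (Suc m) \<subseteq> E m" for m
    by (auto simp: E_def)
  ultimately obtain x y where *: "x \<in> X" "y \<in> X" "\<And>m. (x, y) \<in> E m"
    using compact_pairs_nest[of E] by metis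
  have "x i = y i" if "i < 0" for i
    using *(3)[of "nat \<bar>i\<bar>"] that by (auto simp: E_def)
  with * show ?thesis unfolding left_asymptotic_def E_def by auto
qed

lemma cantor_infinite:
  assumes "cantor_space \<T>"
  shows "infinite X"
proof
  assume "finite X"
  obtain f where "homeomorphic_map \<T> (product_topology (\<lambda>_::nat. discrete_topology (UNIV :: bool set)) UNIV) f"
    using assms unfolding cantor_space_def homeomorphic_space by blast
  then have "f ` X = UNIV"
    using homeomorphic_imp_surjective_map by fastforce
  then have "finite (UNIV :: (nat \<Rightarrow> bool) set)"
    using \<open>finite X\<close> by (metis finite_imageI)
  then show False by (simp add: finite_UNIV_fun)
qed

lemma commutes_translate:
  assumes "automorphism \<T> shift \<phi>" "x \<in> X"
  shows "\<phi> (translate n x) = translate n (\<phi> x)"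
proof -
  have com: "\<phi> (translate 1 y) = translate 1 (\<phi> y)" if "y \<in> X" for y
    using assms(1) that by (simp add: automorphism_def shift_eq_translate)
  have fwd: "\<phi> (translate (int m) y) = translate (int m) (\<phi> y)" if "y \<in> X" for m y
  proof (induction m)
    case (Suc m)
    then show ?case
      using com[OF translate_mem[OF that], of "int m"] by (simp add: translate_def ac_simps)
  qed simp
  show ?thesis
  proof (cases "n \<ge> 0")
    case True
    then show ?thesis using fwd[OF assms(2), of "nat n"] by simp
  next
    case False
    then have n: "int (nat (- n)) = - n" by simp
    have "\<phi> (translate (- n) (translate n x)) = translate (- n) (\<phi> (translate n x))"
      using fwd[OF translate_mem[OF assms(2)], of "nat (- n)" n] unfolding n .
    then show ?thesis
      by (metis translate_translate translate_0 add.left_inverse add.right_inverse)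
  qed
qed

subsection \<open>Parsing by the towers of a Kakutani-Rohlin partition\<close>

lemma continuous_translate: "continuous_map \<T> \<T> (translate n)"
proof -
  have "continuous_map \<T> (full_shift A) (translate n)"
    using continuous_letter by (simp add: full_shift_def continuous_map_componentwise_UNIV)
  then show ?thesis
    using translate_mem by (auto simp: continuous_map_in_subtopology)
qed

lemma level_iff: "x \<in> level \<T> shift P k j \<longleftrightarrow> x \<in> X \<and> translate (int j) x \<in> tower_base P k"
  by (simp add: level_def pull_def shift_funpow)

text \<open>A passage through a tower of height \<open>h\<close> covers the times \<open>c, \<dots>, c + h - 1\<close>, with the base
  visited at the times \<open>c - 1\<close> and \<open>c + h - 1\<close>.\<close>

definition cut :: "(int \<Rightarrow> 'a) kr \<Rightarrow> (int \<Rightarrow> 'a) \<Rightarrow> int \<Rightarrow> bool" where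
  "cut P x c \<longleftrightarrow> translate (c - 1) x \<in> kr_base P"

definition tower_at :: "(int \<Rightarrow> 'a) kr \<Rightarrow> (int \<Rightarrow> 'a) \<Rightarrow> int \<Rightarrow> nat \<Rightarrow> bool" where
  "tower_at P x c k \<longleftrightarrow>
     k \<in> {1..num_towers P} \<and> translate (c + int (tower_height P k) - 1) x \<in> tower_base P k"

text \<open>The partition is fine enough for the atom of a point to determine its letter at time 0,
  so that every tower spells a word.\<close>

definition letters_constant :: "(int \<Rightarrow> 'a) kr \<Rightarrow> bool" where
  "letters_constant P \<longleftrightarrow> (\<forall>U\<in>atoms \<T> shift P. \<forall>x\<in>U. \<forall>y\<in>U. x 0 = y 0)"

text \<open>A tower is traversed from its top level down, hence the index
  \<open>tower_height P k - 1 - j\<close>. Under \<open>letters_constant\<close> the choice of the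
  point is immaterial.\<close>

definition tower_word :: "(int \<Rightarrow> 'a) kr \<Rightarrow> nat \<Rightarrow> 'a list" where
  "tower_word P k =
     map (\<lambda>j. (SOME x. x \<in> level \<T> shift P k (tower_height P k - 1 - j)) 0) [0..<tower_height P k]"

abbreviation ray :: "(int \<Rightarrow> 'a) \<Rightarrow> int \<Rightarrow> nat \<Rightarrow> 'a" where
  "ray x c \<equiv> (\<lambda>i. x (c + int i))"

lemma length_tower_word [simp]: "length (tower_word P k) = tower_height P k"
  by (simp add: tower_word_def)

text \<open>By the last clause of \<open>ckr_partition\<close>, every base point reaches some
  \<open>tower_base P k\<close> after exactly \<open>tower_height P k\<close> steps. A base visit at
  time \<open>c - 1\<close> thus starts a passage at time \<open>c\<close>.\<close>

lemma cut_tower_at: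
  assumes "ckr_partition \<T> shift P" "x \<in> X" "cut P x c"
  obtains k where "tower_at P x c k"
proof -
  have "translate (c - 1) x \<in> (\<Union>k\<in>{1..num_towers P}. pull \<T> shift (tower_height P k) (tower_base P k))"
    using assms unfolding ckr_partition_def cut_def by blast
  then obtain k where "k \<in> {1..num_towers P}"
      "translate (int (tower_height P k)) (translate (c - 1) x) \<in> tower_base P k"
    unfolding pull_def shift_funpow by blast
  then have "tower_at P x c k"
    by (simp add: tower_at_def translate_def algebra_simps)
  then show thesis ..
qed

lemma tower_at_cut: "tower_at P x c k \<Longrightarrow> cut P x (c + int (tower_height P k))"
  unfolding tower_at_def cut_def kr_base_def by blast

lemma tower_height_pos: "ckr_partition \<T> shift P \<Longrightarrow> tower_at P x c k \<Longrightarrow> 0 < tower_height P k"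
  unfolding ckr_partition_def tower_at_def by force

lemma tower_at_letter:
  assumes "letters_constant P" "x \<in> X" "tower_at P x c k" "j < tower_height P k"
  shows "x (c + int j) = tower_word P k ! j"
proof -
  let ?L = "level \<T> shift P k (tower_height P k - 1 - j)"
  have "int (tower_height P k - 1 - j) + (c + int j) = c + int (tower_height P k) - 1"
    using assms(4) by simp
  then have "translate (int (tower_height P k - 1 - j)) (translate (c + int j) x)
      = translate (c + int (tower_height P k) - 1) x"
    by (simp only: translate_translate)
  then have mem: "translate (c + int j) x \<in> ?L"
    using translate_mem[OF assms(2)] assms(3) unfolding level_iff tower_at_def by metis
  then have "(SOME x. x \<in> ?L) \<in> ?L" by (rule someI[of "\<lambda>x. x \<in> ?L"])
  moreover have "?L \<in> atoms \<T> shift P"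
    using assms(3,4) by (force simp: atoms_def level_indices_def tower_at_def)
  ultimately have "translate (c + int j) x 0 = (SOME x. x \<in> ?L) 0"
    using mem assms(1) unfolding letters_constant_def by blast
  then show ?thesis using assms(4) by (simp add: tower_word_def)
qed

lemma tower_at_ray:
  assumes "letters_constant P" "x \<in> X" "tower_at P x c k"
  shows "ray x c = tower_word P k \<frown> ray x (c + int (tower_height P k))"
proof
  fix i
  show "ray x c i = (tower_word P k \<frown> ray x (c + int (tower_height P k))) i"
  proof (cases "i < tower_height P k")
    case True
    then show ?thesis using tower_at_letter[OF assms] by simp
  next
    case False
    then have "c + int (tower_height P k) + int (i - tower_height P k) = c + int i" by simp
    with False show ?thesis by simp
  qed
qed

text \<open>The coinduction runs from cut to cut, since each passage ends at a cut. With a single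
  tower, the block \<open>tower_word P 2\<close> simply never occurs.\<close>

lemma cut_factored:
  assumes "ckr_partition \<T> shift P" "num_towers P \<le> 2" "letters_constant P" "x \<in> X" "cut P x c"
  shows "factored (tower_word P 1) (tower_word P 2) (ray x c)"
  using assms(5)
proof (coinduction arbitrary: c)
  case (factored c)
  obtain k where k: "tower_at P x c k"
    using cut_tower_at[OF assms(1,4) factored] .
  then have "k = 1 \<or> k = 2" using assms(2) by (auto simp: tower_at_def)
  then show ?case
    using tower_at_ray[OF assms(3,4) k] tower_at_cut[OF k] by blast
qed

section \<open>Common cuts of a left asymptotic pair and the place where the parsings split\<close>

lemma openin_kr_base:
  assumes "ckr_partition \<T> shift P"
  shows "openin \<T> (kr_base P)"
  using assms unfolding kr_base_def ckr_partition_def by (intro openin_Union) auto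

lemma ex_cut:
  assumes "ckr_partition \<T> shift P" "z \<in> X"
  obtains c where "cut P z c"
proof -
  have "z \<in> \<Union> (atoms \<T> shift P)"
    using assms by (simp add: ckr_partition_def partition_on_def)
  then obtain k j where "k \<in> {1..num_towers P}" "z \<in> level \<T> shift P k j"
    by (auto simp: atoms_def level_indices_def)
  then have "cut P z (int j + 1)"
    by (auto simp: level_iff cut_def kr_base_def)
  then show thesis ..
qed

text \<open>Agreement at negative times does not directly compare base visits, which may depend on
  later letters. A common backward limit \<open>z\<close> has a cut somewhere, and openness of the
  base passes it on to both points at the same time.\<close>

lemma ex_common_cut:
  assumes P: "ckr_partition \<T> shift P" and xy: "left_asymptotic x y"
  obtains c where "c \<le> 0" "cut P x c" "cut P y c"
proof -
  have "x \<in> X" "y \<in> X" "\<And>i. i < 0 \<Longrightarrow> y i = x i"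
    using xy by (auto simp: left_asymptotic_def)
  then obtain z where z: "z \<in> X"
    "\<And>U N. openin \<T> U \<Longrightarrow> z \<in> U \<Longrightarrow>
       \<exists>n\<ge>N::nat. translate (- int n) x \<in> U \<and> translate (- int n) y \<in> U"
    using asymptotic_backward_limit by metis
  obtain e where e: "cut P z e" using ex_cut[OF P z(1)] .
  let ?U = "{w \<in> X. translate (e - 1) w \<in> kr_base P}"
  have "openin \<T> ?U"
    using openin_continuous_map_preimage[OF continuous_translate openin_kr_base[OF P]] by simp
  moreover have "z \<in> ?U" using z(1) e by (simp add: cut_def)
  ultimately obtain n where "n \<ge> nat e" "translate (- int n) x \<in> ?U" "translate (- int n) y \<in> ?U"
    using z(2) by blast
  then have "e - int n \<le> 0" "cut P x (e - int n)" "cut P y (e - int n)"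
    by (auto simp: cut_def algebra_simps)
  then show thesis by (rule that)
qed

text \<open>From a common cut, equal towers lead to a later common cut. This cannot continue past
  time 0, where the two points differ.\<close>

lemma ex_split_cut:
  assumes P: "ckr_partition \<T> shift P" and lc: "letters_constant P" and xy: "left_asymptotic x y"
  obtains (split)  c k k' where "c \<le> 0" "cut P x c" "cut P y c"
    "k \<noteq> k'" "tower_at P x c k" "tower_at P y c k'"
proof (rule ccontr)
  assume no: "\<not> thesis"
  have same: "k = k'"
    if "c \<le> 0" "cut P x c" "cut P y c" "tower_at P x c k" "tower_at P y c k'" for c k k'
    using that no split[of c k k'] by blast
  have X: "x \<in> X" "y \<in> X" "x 0 \<noteq> y 0"
    using xy by (auto simp: left_asymptotic_def)
  obtain e where e: "e \<le> 0" "cut P x e" "cut P y e"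
    using ex_common_cut[OF P xy] .
  have "\<exists>c\<ge>e + int m. c \<le> 0 \<and> cut P x c \<and> cut P y c" for m
  proof (induction m)
    case 0
    then show ?case using e by auto
  next
    case (Suc m)
    then obtain c where c: "c \<ge> e + int m" "c \<le> 0" "cut P x c" "cut P y c" by blast
    obtain k where k: "tower_at P x c k" using cut_tower_at[OF P X(1) c(3)] .
    obtain k' where "tower_at P y c k'" using cut_tower_at[OF P X(2) c(4)] .
    then have k': "tower_at P y c k" using same[OF c(2-4) k] by blast
    have "x (c + int j) = y (c + int j)" if "j < tower_height P k" for j
      using tower_at_letter[OF lc X(1) k that] tower_at_letter[OF lc X(2) k' that] by simp
    \<comment> \<open>For \<open>j = nat (- c)\<close> the position is time 0, where the letters
      differ; hence the passage ends before time 0.\<close>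
    from this[of "nat (- c)"] have "c + int (tower_height P k) \<le> 0"
      using X(3) c(2) by fastforce
    moreover have "0 < tower_height P k" using tower_height_pos[OF P k] .
    ultimately show ?case
      using c(1) tower_at_cut[OF k] tower_at_cut[OF k']
      by (intro exI[of _ "c + int (tower_height P k)"]) auto
  qed
  from this[of "nat (1 - e)"] show False using e(1) by auto
qed

text \<open>From the split cut \<open>c\<close> on, the two points are distinct concatenations with
  different first blocks, so they branch exactly after \<open>p\<close>. They first differ at time
  0, which forces \<open>c = - int (length p)\<close>. Only the partition determines
  \<open>p\<close>.\<close>

lemma ex_common_prefix:
  assumes P: "ckr_partition \<T> shift P" "num_towers P \<le> 2" and lc: "letters_constant P"
  shows "\<exists>p. \<forall>x y. left_asymptotic x y \<longrightarrow>
    cut P x (- int (length p)) \<and> cut P y (- int (length p)) \<and>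
    (\<forall>i<length p. x (int i - int (length p)) = p ! i)"
proof (cases "\<exists>x y. left_asymptotic x y")
  case True
  \<comment> \<open>A split exhibits two different towers, so both tower words are genuine and
    nonempty.\<close>
  then obtain k k' :: nat where "k \<noteq> k'" "k \<in> {1..num_towers P}" "k' \<in> {1..num_towers P}"
    using ex_split_cut[OF P(1) lc] by (metis tower_at_def)
  then have "1 \<in> {1..num_towers P}" "2 \<in> {1..num_towers P}" by auto
  then have "1 \<le> tower_height P 1" "1 \<le> tower_height P 2"
    using P(1) unfolding ckr_partition_def by blast+
  then have "tower_word P 1 \<noteq> []" "tower_word P 2 \<noteq> []"
    by (auto simp flip: length_greater_0_conv)
  then obtain p where p: "branches_after (tower_word P 1) (tower_word P 2) p"
    using branching_prefix by blast
  show ?thesis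
  proof (intro exI[of _ p] allI impI)
    fix x y assume xy: "left_asymptotic x y"
    then have X: "x \<in> X" "y \<in> X" "x 0 \<noteq> y 0" "\<And>i. i < 0 \<Longrightarrow> x i = y i"
      by (auto simp: left_asymptotic_def)
    obtain c k k' where c: "c \<le> 0" and cuts: "cut P x c" "cut P y c"
      and k: "k \<noteq> k'" "tower_at P x c k" "tower_at P y c k'"
      using ex_split_cut[OF P(1) lc xy] .
    have "{k, k'} = {1, 2}" using k P(2) by (auto simp: tower_at_def)
    then have branch: "branches_after (tower_word P k) (tower_word P k') p"
      and rest: "factored (tower_word P k) (tower_word P k') (ray x (c + int (tower_height P k)))"
        "factored (tower_word P k) (tower_word P k') (ray y (c + int (tower_height P k')))"
      using p branches_after_swap[OF p] factored_swap
        cut_factored[OF P lc X(1) tower_at_cut[OF k(2)]]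
        cut_factored[OF P lc X(2) tower_at_cut[OF k(3)]]
      by (auto simp: doubleton_eq_iff)
    have "ray x c (nat (- c)) \<noteq> ray y c (nat (- c))"
      using c X(3) by simp
    then have "ray x c \<noteq> ray y c" by metis
    then obtain r r' where r: "ray x c = p \<frown> r" "ray y c = p \<frown> r'" "r 0 \<noteq> r' 0"
      using branch rest tower_at_ray[OF lc X(1) k(2)] tower_at_ray[OF lc X(2) k(3)]
      unfolding branches_after_def by metis
    have "x (c + int (length p)) \<noteq> y (c + int (length p))"
      using fun_cong[OF r(1), of "length p"] fun_cong[OF r(2), of "length p"] r(3) by simp
    \<comment> \<open>The letters after \<open>p\<close> differ, so they are not at a negative time;
      the letters within \<open>p\<close> agree, so time 0 is not among them.\<close>
    then have "0 \<le> c + int (length p)" using X(4) by force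
    moreover have pre: "x (c + int i) = p ! i \<and> y (c + int i) = p ! i" if "i < length p" for i
      using fun_cong[OF r(1), of i] fun_cong[OF r(2), of i] that by simp
    then have "\<not> nat (- c) < length p" using c X(3) by fastforce
    ultimately have "c = - int (length p)" using c by linarith
    with cuts show "cut P x (- int (length p)) \<and> cut P y (- int (length p)) \<and>
        (\<forall>i<length p. x (int i - int (length p)) = p ! i)"
      using pre by (simp add: algebra_simps)
  qed
qed auto

section \<open>Atoms fine enough to determine letters, and the common past\<close>

lemma closedin_atom:
  assumes "ckr_partition \<T> shift P" "U \<in> atoms \<T> shift P"
  shows "closedin \<T> U"
proof -
  obtain k j where kj: "k \<in> {1..num_towers P}" "U = level \<T> shift P k j"
    using assms(2) by (auto simp: atoms_def level_indices_def)
  then have "closedin \<T> (tower_base P k)"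
    using assms(1) unfolding ckr_partition_def by blast
  then have "closedin \<T> {x \<in> topspace \<T>. translate (int j) x \<in> tower_base P k}"
    by (rule closedin_continuous_map_preimage[OF continuous_translate])
  moreover have "U = {x \<in> topspace \<T>. translate (int j) x \<in> tower_base P k}"
    using kj(2) by (auto simp: level_iff)
  ultimately show ?thesis by simp
qed

lemma finite_atoms: "finite (atoms \<T> shift P)"
  by (simp add: atoms_def level_indices_def)

text \<open>Failure to separate \<open>x\<close> from \<open>y\<close> is inherited by intersections
  and unions. The generators will be the atoms of all levels.\<close>

lemma generate_topology_on_not_separating:
  assumes "generate_topology_on S U" "\<And>V. V \<in> S \<Longrightarrow> x \<in> V \<longleftrightarrow> y \<in> V"
  shows "x \<in> U \<longleftrightarrow> y \<in> U"
  using assms by (induction rule: generate_topology_on.induct) blast+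

lemma atoms_refine:
  assumes "nested_ckr \<T> shift P" "n \<le> m" "U \<in> atoms \<T> shift (P m)"
  shows "\<exists>V\<in>atoms \<T> shift (P n). U \<subseteq> V"
  using assms(2,3)
proof (induction m arbitrary: U rule: dec_induct)
  case (step m)
  then obtain U' where "U' \<in> atoms \<T> shift (P m)" "U \<subseteq> U'"
    using assms(1) unfolding nested_ckr_def refines_def by meson
  with step.IH show ?case by (meson order_trans)
qed blast

text \<open>Otherwise compactness gives two points with different letters at time 0 that share an
  atom at every level, although the atoms generate the topology.\<close>

lemma eventually_letters_constant:
  assumes nest: "nested_ckr \<T> shift P"
  shows "\<exists>N. \<forall>n\<ge>N. letters_constant (P n)"
proof -
  have ckr: "ckr_partition \<T> shift (P n)" for n
    using nest by (simp add: nested_ckr_def)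
  have "\<exists>N. letters_constant (P N)"
  proof (rule ccontr)
    assume no: "\<not> ?thesis"
    define D where "D = {(x, y) \<in> X \<times> X. id x 0 \<noteq> id y 0}"
    define E where "E n = (\<Union>U\<in>atoms \<T> shift (P n). U \<times> U) \<inter> D" for n
    have "closedin (prod_topology \<T> \<T>) (E n)" for n
    proof -
      have "closedin (prod_topology \<T> \<T>) (\<Union>U\<in>atoms \<T> shift (P n). U \<times> U)"
        using closedin_atom[OF ckr] finite_atoms
        by (intro closedin_Union) (auto simp: closedin_prod_Times_iff)
      then show ?thesis
        unfolding E_def D_def using closedin_letters[OF continuous_map_id, of "(\<noteq>)" 0]
        by (rule closedin_Int)
    qed
    moreover have "E (Suc n) \<subseteq> E n" for n
    proof
      fix w assume "w \<in> E (Suc n)"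
      then obtain U where U: "U \<in> atoms \<T> shift (P (Suc n))" "w \<in> U \<times> U" "w \<in> D"
        unfolding E_def by blast
      then obtain V where "V \<in> atoms \<T> shift (P n)" "U \<subseteq> V"
        using atoms_refine[OF nest, of n "Suc n"] by auto
      then show "w \<in> E n" using U unfolding E_def by blast
    qed
    moreover have "E n \<noteq> {}" for n
    proof -
      obtain U x y where U: "U \<in> atoms \<T> shift (P n)" "x \<in> U" "y \<in> U" "x 0 \<noteq> y 0"
        using no unfolding letters_constant_def by blast
      moreover have "U \<subseteq> X" using closedin_subset[OF closedin_atom[OF ckr U(1)]] by simp
      ultimately have "(x, y) \<in> E n" unfolding E_def D_def by auto
      then show ?thesis by blast
    qed
    ultimately obtain x y where xy: "x \<in> X" "y \<in> X" "\<And>n. (x, y) \<in> E n"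
      using compact_pairs_nest[of E] by metis
    have "x \<in> V \<longleftrightarrow> y \<in> V" if V: "V \<in> (\<Union>n. atoms \<T> shift (P n))" for V
    proof -
      obtain n where n: "V \<in> atoms \<T> shift (P n)" using V by blast
      obtain U where U: "U \<in> atoms \<T> shift (P n)" "x \<in> U" "y \<in> U"
        using xy(3)[of n] unfolding E_def by blast
      have "disjoint (atoms \<T> shift (P n))"
        using ckr[of n] by (simp add: ckr_partition_def partition_on_def)
      then have "V = U \<or> V \<inter> U = {}" using n U(1) unfolding disjoint_def by blast
      with U show ?thesis by blast
    qed
    moreover have top: "topology_generated_by (\<Union>n. atoms \<T> shift (P n)) = \<T>"
      using nest unfolding nested_ckr_def by blast
    \<comment> \<open>The interval is written with \<open>int 0\<close> to match
      \<open>openin_cylinder\<close> for \<open>m = 0\<close>.\<close>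
    have "generate_topology_on (\<Union>n. atoms \<T> shift (P n)) {w \<in> X. \<forall>i\<in>{- int 0..int 0}. w i = x i}"
      by (rule openin_topology_generated_by, unfold top, rule openin_cylinder[OF xy(1)])
    ultimately have "x \<in> {w \<in> X. \<forall>i\<in>{- int 0..int 0}. w i = x i} \<longleftrightarrow> y \<in> {w \<in> X. \<forall>i\<in>{- int 0..int 0}. w i = x i}"
      by (rule generate_topology_on_not_separating[rotated])
    then have "x 0 = y 0" using xy(1) by simp
    with xy(3)[of 0] show False by (simp add: E_def D_def)
  qed
  then obtain N where N: "letters_constant (P N)" ..
  have "letters_constant (P n)" if le: "N \<le> n" for n
    unfolding letters_constant_def
  proof (intro ballI)
    fix U x y assume U: "U \<in> atoms \<T> shift (P n)" "x \<in> U" "y \<in> U"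
    obtain V where "V \<in> atoms \<T> shift (P N)" "U \<subseteq> V"
      using atoms_refine[OF nest le U(1)] by blast
    with N U show "x 0 = y 0" unfolding letters_constant_def by blast
  qed
  then show ?thesis by blast
qed

text \<open>At each fine level all pairs have the same word \<open>p n\<close> just before time 0.
  It remains to see that these words become long enough to cover time \<open>i\<close>.\<close>

lemma past_unique:
  assumes nest: "nested_ckr \<T> shift P" and rank: "\<And>n. num_towers (P n) \<le> 2"
    and xy: "left_asymptotic x y" and xy': "left_asymptotic x' y'" and "i < 0"
  shows "x i = x' i"
proof -
  have ckr: "ckr_partition \<T> shift (P n)" for n
    using nest by (simp add: nested_ckr_def)
  have dec: "kr_base (P m) \<subseteq> kr_base (P n)" if "n \<le> m" for n m
  proof (rule lift_Suc_antimono_le[of "\<lambda>n. kr_base (P n)", OF _ that])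
    show "kr_base (P (Suc n)) \<subseteq> kr_base (P n)" for n
      using nest unfolding nested_ckr_def by blast
  qed
  have "\<exists>b. (\<Inter>n. kr_base (P n)) = {b}"
    using nest by (simp add: nested_ckr_def)
  then obtain b where b: "(\<Inter>n. kr_base (P n)) = {b}" ..
  obtain N where N: "\<And>n. n \<ge> N \<Longrightarrow> letters_constant (P n)"
    using eventually_letters_constant[OF nest] by blast
  have "\<exists>p. \<forall>x y. n \<ge> N \<longrightarrow> left_asymptotic x y \<longrightarrow>
      cut (P n) x (- int (length p)) \<and> cut (P n) y (- int (length p)) \<and>
      (\<forall>i<length p. x (int i - int (length p)) = p ! i)" for n
    using ex_common_prefix[OF ckr rank N, of n] by blast
  then obtain p where p: "\<And>n x y. n \<ge> N \<Longrightarrow> left_asymptotic x y \<Longrightarrow>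
      cut (P n) x (- int (length (p n))) \<and> cut (P n) y (- int (length (p n))) \<and>
      (\<forall>i<length (p n). x (int i - int (length (p n))) = p n ! i)"
    by metis
  have "\<exists>n\<ge>N. nat (- i) \<le> length (p n)"
  proof (rule ccontr)
    assume "\<not> ?thesis"
    then have "(\<lambda>n. length (p n)) ` {N..} \<subseteq> {..<nat (- i)}" by force
    then have "finite ((\<lambda>n. length (p n)) ` {N..})" by (rule finite_subset) simp
    \<comment> \<open>Bounded lengths would repeat one value at infinitely many levels, giving a cut
      at the same place at all of these.\<close>
    then obtain a where a: "a \<ge> N" "infinite {n \<in> {N..}. length (p n) = length (p a)}"
      using pigeonhole_infinite[of "{N..}" "\<lambda>n. length (p n)"] infinite_Ici by auto
    define e where "e = - int (length (p a)) - 1"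
    \<comment> \<open>The bases decrease, so membership at infinitely many levels gives membership
      at all. Both translates then equal the single point \<open>b\<close>, although
      \<open>x\<close> and \<open>y\<close> differ.\<close>
    have "translate e x \<in> kr_base (P n) \<and> translate e y \<in> kr_base (P n)" for n
    proof -
      obtain m where m: "m \<ge> n" "m \<ge> N" "length (p m) = length (p a)"
        using a(2) unfolding infinite_nat_iff_unbounded_le by auto
      then show ?thesis
        using p[OF m(2) xy] dec[OF m(1)] unfolding cut_def e_def by auto
    qed
    then have "translate e x \<in> (\<Inter>n. kr_base (P n))" "translate e y \<in> (\<Inter>n. kr_base (P n))"
      by blast+
    then have "translate e x = translate e y" using b by simp
    then have "translate e x (- e) = translate e y (- e)" by (rule arg_cong)
    then show False using xy by (simp add: left_asymptotic_def)
  qed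
  then obtain n where n: "n \<ge> N" "nat (- i) \<le> length (p n)" by blast
  define j where "j = nat (i + int (length (p n)))"
  have "j < length (p n)" "int j - int (length (p n)) = i"
    using n(2) assms(5) unfolding j_def by linarith+
  then show ?thesis
    using p[OF n(1) xy] p[OF n(1) xy'] by metis
qed

subsection \<open>Automorphisms\<close>

text \<open>The finite window of \<open>\<phi>\<close> keeps the images equal far to the left, and
  injectivity makes them differ somewhere. Translation moves the first difference to time 0.\<close>

lemma automorphism_left_asymptotic:
  assumes aut: "automorphism \<T> shift \<phi>" and xy: "left_asymptotic x y"
  obtains n where "left_asymptotic (translate n (\<phi> x)) (translate n (\<phi> y))"
proof -
  have X: "x \<in> X" "y \<in> X" "x 0 \<noteq> y 0" "\<And>i. i < 0 \<Longrightarrow> x i = y i"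
    using xy by (auto simp: left_asymptotic_def)
  have hom: "homeomorphic_map \<T> \<T> \<phi>" using aut by (simp add: automorphism_def)
  obtain m :: nat where m: "\<forall>x\<in>X. \<forall>y\<in>X. (\<forall>i\<in>{- int m..int m}. x i = y i) \<longrightarrow> \<phi> x 0 = \<phi> y 0"
    using sliding_block_window[OF homeomorphic_imp_continuous_map[OF hom]] by blast
  have far: "\<phi> x i = \<phi> y i" if "i < - int m" for i
  proof -
    have "\<forall>j\<in>{- int m..int m}. translate i x j = translate i y j"
      using X(4) that by simp
    then have "\<phi> (translate i x) 0 = \<phi> (translate i y) 0"
      using m translate_mem X(1,2) by blast
    then show ?thesis
      using commutes_translate[OF aut X(1)] commutes_translate[OF aut X(2)] by simp
  qed
  have "inj_on \<phi> X" using homeomorphic_imp_injective_map[OF hom] by simp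
  then have "\<phi> x \<noteq> \<phi> y" using X unfolding inj_on_def by metis
  then obtain i where "\<phi> x i \<noteq> \<phi> y i" by blast
  moreover from this far have "- int m \<le> i" by (metis not_le)
  \<comment> \<open>Counting from \<open>- int m\<close> turns the first difference into a least
    natural number.\<close>
  ultimately have "\<exists>k. \<phi> x (int k - int m) \<noteq> \<phi> y (int k - int m)"
    by (intro exI[of _ "nat (i + int m)"]) simp
  then obtain k where k: "\<phi> x (int k - int m) \<noteq> \<phi> y (int k - int m)"
      and least: "\<And>l. l < k \<Longrightarrow> \<phi> x (int l - int m) = \<phi> y (int l - int m)"
    using exists_least_iff[of "\<lambda>k. \<phi> x (int k - int m) \<noteq> \<phi> y (int k - int m)"] by blast
  have "\<phi> x i = \<phi> y i" if "i < int k - int m" for i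
  proof (cases "i < - int m")
    case False
    then have "nat (i + int m) < k" "int (nat (i + int m)) - int m = i"
      using that by linarith+
    then show ?thesis using least by metis
  qed (rule far)
  moreover have "\<phi> x \<in> X" "\<phi> y \<in> X"
    using homeomorphic_imp_surjective_map[OF hom] X by auto
  ultimately have "left_asymptotic (translate (int k - int m) (\<phi> x)) (translate (int k - int m) (\<phi> y))"
    using k by (simp add: left_asymptotic_def translate_mem)
  then show thesis by (rule that)
qed

text \<open>Take a common backward limit \<open>z\<close> of \<open>x\<close> and
  \<open>\<psi> x\<close>. The translates of \<open>\<psi> x\<close> come near \<open>z\<close>, but
  also near \<open>\<psi> z\<close>, being images of the translates of \<open>x\<close>.\<close>

lemma fixed_point_if_asymptotic:
  assumes cont: "continuous_map \<T> \<T> \<psi>"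
    and comm: "\<And>w n. w \<in> X \<Longrightarrow> \<psi> (translate n w) = translate n (\<psi> w)"
    and "x \<in> X" and past: "\<And>i. i < 0 \<Longrightarrow> \<psi> x i = x i"
  shows "\<exists>z\<in>X. \<psi> z = z"
proof -
  have map: "\<psi> w \<in> X" if "w \<in> X" for w
    using continuous_map_funspace[OF cont] that by auto
  obtain z where z: "z \<in> X"
    "\<And>U N. openin \<T> U \<Longrightarrow> z \<in> U \<Longrightarrow>
       \<exists>n\<ge>N::nat. translate (- int n) x \<in> U \<and> translate (- int n) (\<psi> x) \<in> U"
    using asymptotic_backward_limit[OF \<open>x \<in> X\<close> map[OF \<open>x \<in> X\<close>] past] by blast
  have "\<psi> z = z"
  proof (rule ccontr)
    assume "\<psi> z \<noteq> z"
    then obtain U V where UV: "openin \<T> U" "openin \<T> V" "\<psi> z \<in> U" "z \<in> V" "disjnt U V"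
      using Hausdorff z(1) map[OF z(1)] unfolding Hausdorff_space_def by (metis topspace_eq)
    have "openin \<T> (V \<inter> {w \<in> X. \<psi> w \<in> U})"
      using openin_continuous_map_preimage[OF cont UV(1)] UV(2) by (simp add: openin_Int)
    moreover have "z \<in> V \<inter> {w \<in> X. \<psi> w \<in> U}" using UV z(1) by simp
    ultimately obtain n where
      "translate (- int n) x \<in> V \<inter> {w \<in> X. \<psi> w \<in> U}"
      "translate (- int n) (\<psi> x) \<in> V \<inter> {w \<in> X. \<psi> w \<in> U}"
      using z(2) by blast
    then have "translate (- int n) (\<psi> x) \<in> U" "translate (- int n) (\<psi> x) \<in> V"
      using comm[OF \<open>x \<in> X\<close>, of "- int n"] by auto
    then show False using UV(5) by (auto simp: disjnt_iff)
  qed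
  with z(1) show ?thesis by blast
qed

text \<open>The fixed point set is closed, shift invariant and contains \<open>z\<close>.\<close>

lemma minimal_fixed_point_imp_id:
  assumes min: "minimal_map \<T> shift" and cont: "continuous_map \<T> \<T> \<psi>"
    and comm: "\<And>w n. w \<in> X \<Longrightarrow> \<psi> (translate n w) = translate n (\<psi> w)"
    and z: "z \<in> X" "\<psi> z = z" and "x \<in> X"
  shows "\<psi> x = x"
proof -
  let ?F = "{w \<in> X. \<psi> w = w}"
  have "closedin \<T> {w \<in> topspace \<T>. \<psi> w = id w}"
    by (rule closedin_continuous_maps_eq[OF Hausdorff cont continuous_map_id])
  then have "closedin \<T> ?F" by simp
  moreover have inv: "translate n w \<in> ?F" if "w \<in> ?F" for n w
    using that comm[of w n] translate_mem[of w n] by simp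
  have "shift ` ?F = ?F"
  proof
    show "shift ` ?F \<subseteq> ?F" using inv unfolding shift_eq_translate by blast
    show "?F \<subseteq> shift ` ?F"
    proof
      fix w assume "w \<in> ?F"
      then have mem: "translate (-1) w \<in> ?F" by (rule inv)
      show "w \<in> shift ` ?F"
        by (rule image_eqI[OF _ mem]) (simp add: shift_eq_translate)
    qed
  qed
  ultimately have "?F = {} \<or> ?F = X"
    using min unfolding minimal_map_def topspace_eq by blast
  then show ?thesis using z \<open>x \<in> X\<close> by blast
qed

end

theorem mainTheorem12:
  fixes A :: "'a set" and X :: "(int \<Rightarrow> 'a) set" and \<phi> :: "(int \<Rightarrow> 'a) \<Rightarrow> (int \<Rightarrow> 'a)"
  assumes "subshift A X"
    and "minimal_cantor_system (subshift_topology A X) shift"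
    and "finite_topological_rank (subshift_topology A X) shift"
    and "topological_rank (subshift_topology A X) shift = 2"
    and "automorphism (subshift_topology A X) shift \<phi>"
  shows "\<exists>n::int. \<forall>x\<in>X. \<phi> x = int_iterate shift n x"
proof -
  interpret shift_space A X by unfold_locales (rule assms(1))
  \<comment> \<open>Finite rank ensures that the minimum in \<open>topological_rank\<close> is
    attained.\<close>
  have "rank_bounded_by \<T> shift 2"
    using assms(3,4) unfolding finite_topological_rank_def topological_rank_def by (metis LeastI_ex)
  then obtain P where P: "nested_ckr \<T> shift P" "\<And>n. num_towers (P n) \<le> 2"
    unfolding rank_bounded_by_def by blast
  obtain x y where xy: "left_asymptotic x y"
    using ex_left_asymptotic cantor_infinite assms(2) unfolding minimal_cantor_system_def by blast
  then have "x \<in> X" by (simp add: left_asymptotic_def)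
  obtain n where n: "left_asymptotic (translate n (\<phi> x)) (translate n (\<phi> y))"
    using automorphism_left_asymptotic[OF assms(5) xy] .
  define \<psi> where "\<psi> w = translate n (\<phi> w)" for w
  have "continuous_map \<T> \<T> \<phi>"
    using assms(5) by (simp add: automorphism_def homeomorphic_imp_continuous_map)
  from continuous_map_compose[OF this continuous_translate[of n]]
  have cont: "continuous_map \<T> \<T> \<psi>" by (simp add: \<psi>_def[abs_def] o_def)
  have comm: "\<psi> (translate m w) = translate m (\<psi> w)" if "w \<in> X" for m w
    unfolding \<psi>_def commutes_translate[OF assms(5) that] by (simp add: add.commute)
  \<comment> \<open>The image pair, translated by \<open>n\<close>, and the original pair are both
    left asymptotic, so their first points have the same past.\<close>
  have "\<psi> x i = x i" if "i < 0" for i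
    unfolding \<psi>_def by (rule past_unique[OF P n xy that])
  then obtain z where z: "z \<in> X" "\<psi> z = z"
    using fixed_point_if_asymptotic[OF cont comm \<open>x \<in> X\<close>] by blast
  have "\<phi> w = int_iterate shift (- n) w" if "w \<in> X" for w
  proof -
    have "\<psi> w = w"
      using minimal_fixed_point_imp_id[OF _ cont comm z that] assms(2)
      unfolding minimal_cantor_system_def by blast
    then have "translate (- n) (\<psi> w) = translate (- n) w" by (rule arg_cong)
    then show ?thesis unfolding \<psi>_def int_iterate_shift_eq by simp
  qed
  then show ?thesis by blast
qed

end
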